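(* If $\pi\in\mathfrak S_n$ is a permutation with pinnacle set $P$ and vale set $V$, then there is a unique FS-minimal permutation in the dual Foata-Strehl orbit $\mathrm{Orb}_\varphi(\pi)$ of $\pi$.
   Context: $[n]=\{1,\dots,n\}$ and $\mathfrak S_n$ is the set of permutations $\pi=\pi_1\cdots\pi_n$ of $[n]$ in one-line notation, with the convention $\pi_0=\pi_{n+1}=\infty$. For $i\in[n]$, the value $\pi_i$ is a pinnacle of $\pi$ if $\pi_{i-1}<\pi_i>\pi_{i+1}$ and a vale of $\pi$ if $\pi_{i-1}>\pi_i<\pi_{i+1}$; $\mathrm{Pin}(\pi)$ and $\mathrm{Vale}(\pi)$ are the sets of pinnacles and vales of $\pi$. For a word $\sigma$ of distinct positive integers and a letter $x$ of $\sigma$, the $x$-factorization of $\sigma$ is $\sigma=w_1w_2\,x\,w_4w_5$, where $w_2$ (resp. $w_4$) is the longest contiguous, possibly empty, subword immediately to the left (resp. right) of $x$ all of whose letters are less than $x$. Define $\varphi_x(\sigma)=w_1w_4\,x\,w_2w_5$. For $S\subseteq[n]$ and $\pi\in\mathfrak S_n$, $\varphi_S(\pi)$ is obtained by composing the maps $\varphi_x$, $x\in S$ (in any order; they commute), with $\varphi_\emptyset$ the identity. The dual Foata-Strehl orbit of $\pi$ is $\mathrm{Orb}_\varphi(\pi)=\{\varphi_S(\pi):S\subseteq[n]\}$. For a set $A\subseteq[n]$, $\pi|_{A}$ is the word obtained from $\pi$ by keeping only the letters in $A$, in the order they appear in $\pi$. $\max(w)$ denotes the largest letter of a nonempty word $w$.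 A double descent of $\pi$ is an index $i\in[n]$ with $\pi_{i-1}>\pi_i>\pi_{i+1}$ (with $\pi_0=\pi_{n+1}=\infty$). A permutation $\pi\in\mathfrak S_n$ with pinnacle set $P$ and vale set $V$ is FS-minimal if $\pi$ contains no double descents and, for each $p\in P$, the $p$-factorization $w_1w_2\,p\,w_4w_5$ of $\pi|_{P\cup V}$ satisfies $\max(w_2)<\max(w_4)$ (here $w_2,w_4$ are automatically nonempty). *)

theory Defs
  imports "HOL-Combinatorics.Multiset_Permutations" "HOL-Library.Extended_Nat"
begin

text \<open>
  A permutation of \<open>[n]\<close> in one-line notation is a list in \<^term>\<open>permutations_of_set {1..n}\<close>.
\<close>

text \<open>
  The entry \<open>\<pi>\<^sub>i\<close> with indices counted from 1, so that \<open>\<pi>\<^sub>0 = \<pi>\<^sub>n\<^sub>+\<^sub>1 = \<infinity>\<close>.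
\<close>
definition entry :: "nat list \<Rightarrow> nat \<Rightarrow> enat" where
  "entry \<pi> i = (if i \<in> {1..length \<pi>} then enat (\<pi> ! (i - 1)) else \<infinity>)"

definition Pin :: "nat list \<Rightarrow> nat set" where
  "Pin \<pi> = {x. \<exists>i\<in>{1..length \<pi>}. enat x = entry \<pi> i \<and>
                 entry \<pi> (i - 1) < entry \<pi> i \<and> entry \<pi> i > entry \<pi> (i + 1)}"

definition Vale :: "nat list \<Rightarrow> nat set" where
  "Vale \<pi> = {x. \<exists>i\<in>{1..length \<pi>}. enat x = entry \<pi> i \<and>
                  entry \<pi> (i - 1) > entry \<pi> i \<and> entry \<pi> i < entry \<pi> (i + 1)}"

definition double_descent :: "nat list \<Rightarrow> nat \<Rightarrow> bool" where
  "double_descent \<pi> i \<longleftrightarrow> i \<in> {1..length \<pi>} \<and>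
     entry \<pi> (i - 1) > entry \<pi> i \<and> entry \<pi> i > entry \<pi> (i + 1)"

text \<open>
  The \<open>x\<close>-factorization \<open>\<sigma> = w\<^sub>1 w\<^sub>2 x w\<^sub>4 w\<^sub>5\<close>, returned as \<open>(w\<^sub>1, w\<^sub>2, w\<^sub>4, w\<^sub>5)\<close>. It is meaningful
  only if \<open>\<sigma>\<close> has distinct letters and \<open>x\<close> is one of them. The reversals make \<open>w\<^sub>2\<close> the longest
  suffix, of the part of \<open>\<sigma>\<close> to the left of \<open>x\<close>, whose letters are all less than \<open>x\<close>.
\<close>
definition x_factorization ::
  "nat \<Rightarrow> nat list \<Rightarrow> nat list \<times> nat list \<times> nat list \<times> nat list" where
  "x_factorization x \<sigma> =
     (let l = takeWhile (\<lambda>y. y \<noteq> x) \<sigma>;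
          r = tl (dropWhile (\<lambda>y. y \<noteq> x) \<sigma>)
      in (rev (dropWhile (\<lambda>y. y < x) (rev l)), rev (takeWhile (\<lambda>y. y < x) (rev l)),
          takeWhile (\<lambda>y. y < x) r, dropWhile (\<lambda>y. y < x) r))"

definition dual_fs :: "nat \<Rightarrow> nat list \<Rightarrow> nat list" where
  "dual_fs x \<sigma> =
     (case x_factorization x \<sigma> of (w1, w2, w4, w5) \<Rightarrow> w1 @ w4 @ [x] @ w2 @ w5)"

text \<open>
  The maps \<^term>\<open>dual_fs x\<close> commute on permutations, so \<open>\<phi>\<^sub>S\<close> does not depend on the order of
  composition; for definiteness they are applied in increasing order of \<open>x \<in> S\<close>.
\<close>
definition dual_fs_set :: "nat set \<Rightarrow> nat list \<Rightarrow> nat list" where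
  "dual_fs_set S \<pi> = fold dual_fs (sorted_list_of_set S) \<pi>"

definition dual_fs_orbit :: "nat \<Rightarrow> nat list \<Rightarrow> nat list set" where
  "dual_fs_orbit n \<pi> = {dual_fs_set S \<pi> | S. S \<subseteq> {1..n}}"

definition restrict_word :: "nat set \<Rightarrow> nat list \<Rightarrow> nat list" where
  "restrict_word A \<pi> = filter (\<lambda>x. x \<in> A) \<pi>"

text \<open>
  In the restricted word, both neighbours of a pinnacle exist and are vales smaller than it, so
  \<open>w\<^sub>2\<close> and \<open>w\<^sub>4\<close> are nonempty and \<^const>\<open>Max\<close> is never applied to the empty set.
\<close>
definition FS_minimal :: "nat \<Rightarrow> nat list \<Rightarrow> bool" where
  "FS_minimal n \<pi> \<longleftrightarrow>
     \<pi> \<in> permutations_of_set {1..n} \<and>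
     (\<nexists>i. double_descent \<pi> i) \<and>
     (\<forall>p\<in>Pin \<pi>. case x_factorization p (restrict_word (Pin \<pi> \<union> Vale \<pi>) \<pi>) of
        (w1, w2, w4, w5) \<Rightarrow> Max (set w2) < Max (set w4))"

end

theory Submission
  imports Defs "HOL-Library.Tree"
begin

text \<open>
  A word with distinct letters is the inorder reading of exactly one decreasing binary tree: the
  root is the largest letter, and the words before and after it are read from the two subtrees.
  If \<open>Node l x r\<close> occurs in this tree, then the \<open>x\<close>-factorization has \<open>w\<^sub>2 = inorder l\<close> and
  \<open>w\<^sub>4 = inorder r\<close>, so \<open>\<phi>\<^sub>x\<close> exchanges the two subtrees of the node \<open>x\<close>
  (\<open>dual_fs_inorder\<close>), and the orbit consists of the trees obtained by choosing, independently at
  every node, whether to exchange its subtrees (\<open>dual_fs_set_inorder\<close>).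

  The left neighbour of \<open>x\<close> is smaller than \<open>x\<close> if and only if \<open>l\<close> is not empty, and likewise on
  the right. Hence the pinnacles are the nodes with two children, the vales are the childless
  nodes, and a double descent is a node with a right child only. In particular the set
  \<open>A = P \<union> V\<close> is the same for the whole orbit. Restricting the word to \<open>A\<close> only deletes nodes with
  one child, and this does not merge the parts of a factorization. So FS-minimality is a condition
  at each node separately (\<open>FS_minimal_inorder\<close>): an only child is a left child, and of two
  nonempty subtrees the one whose largest letter in \<open>A\<close> is larger is on the right. Every nonempty
  subtree contains a vale, and the two subtrees have no common letter, so these maxima exist and
  differ. Therefore exactly one of the two orders is allowed at a node with at least one child; at
  a childless node both orders give the same tree.
\<close>

section \<open>Decreasing binary trees\<close>

fun decreasing :: "nat tree \<Rightarrow> bool" where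
  "decreasing Leaf \<longleftrightarrow> True"
| "decreasing (Node l x r) \<longleftrightarrow> decreasing l \<and> decreasing r \<and>
     (\<forall>y\<in>set_tree l \<union> set_tree r. y < x) \<and> set_tree l \<inter> set_tree r = {}"

lemma decreasing_distinct: "decreasing t \<Longrightarrow> distinct (inorder t)"
  by (induction t) auto

text \<open>Split the word at its largest letter, which becomes the root.\<close>

lemma ex_decreasing_tree: "distinct xs \<Longrightarrow> \<exists>t. decreasing t \<and> inorder t = xs"
proof (induction xs rule: length_induct)
  case (1 xs)
  show ?case
  proof (cases "xs = []")
    case True
    then have "decreasing Leaf \<and> inorder Leaf = xs" by simp
    then show ?thesis by blast
  next
    case False
    define m where "m = Max (set xs)"
    have "m \<in> set xs" using False by (simp add: m_def)
    then obtain u v where xs: "xs = u @ m # v" by (meson split_list)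
    have le: "\<forall>y\<in>set xs. y \<le> m" by (simp add: m_def)
    have "length u < length xs" "length v < length xs" "distinct u" "distinct v"
      using 1(2) by (simp_all add: xs)
    then obtain l r where l: "decreasing l" "inorder l = u" and r: "decreasing r" "inorder r = v"
      using 1(1) by blast
    have "set_tree l = set u" "set_tree r = set v" using l r by (metis set_inorder)+
    then have "decreasing (Node l m r)" 
      using l(1) r(1) le 1(2) by (auto simp: xs order.order_iff_strict)
    moreover have "inorder (Node l m r) = xs" using l r xs by simp
    ultimately show ?thesis by blast
  qed
qed

lemma subtrees_set_tree: "Node l x r \<in> subtrees t \<Longrightarrow> insert x (set_tree l \<union> set_tree r) \<subseteq> set_tree t"
  by (induction t) auto

lemma set_tree_subtrees: "x \<in> set_tree t \<Longrightarrow> \<exists>l r. Node l x r \<in> subtrees t"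
  by (induction t) auto

lemma decreasing_subtrees: "decreasing t \<Longrightarrow> s \<in> subtrees t \<Longrightarrow> decreasing s"
  by (induction t) auto

definition branching :: "'a tree \<Rightarrow> 'a set" where
  "branching t = {x. \<exists>l r. Node l x r \<in> subtrees t \<and> l \<noteq> Leaf \<and> r \<noteq> Leaf}"

definition childless :: "'a tree \<Rightarrow> 'a set" where
  "childless t = {x. Node Leaf x Leaf \<in> subtrees t}"

lemma branching_simps [simp]:
  "branching Leaf = {}"
  "branching (Node l x r) =
     (if l \<noteq> Leaf \<and> r \<noteq> Leaf then {x} else {}) \<union> branching l \<union> branching r"
  by (auto simp: branching_def)

lemma childless_simps [simp]:
  "childless Leaf = {}"
  "childless (Node l x r) =
     (if l = Leaf \<and> r = Leaf then {x} else {}) \<union> childless l \<union> childless r"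
  by (auto simp: childless_def)

lemma childless_nonempty: "t \<noteq> Leaf \<Longrightarrow> childless t \<noteq> {}"
  by (induction t) auto

lemma childless_subset: "childless t \<subseteq> set_tree t"
  by (induction t) auto

section \<open>Exchanging subtrees\<close>

fun exchange :: "'a set \<Rightarrow> 'a tree \<Rightarrow> 'a tree" where
  "exchange S Leaf = Leaf"
| "exchange S (Node l x r) =
     (if x \<in> S then Node (exchange S r) x (exchange S l)
      else Node (exchange S l) x (exchange S r))"

lemma exchange_eq_Leaf [simp]: "exchange S t = Leaf \<longleftrightarrow> t = Leaf"
  by (cases t) auto

lemma set_tree_exchange [simp]: "set_tree (exchange S t) = set_tree t"
  by (induction t) auto

lemma decreasing_exchange: "decreasing t \<Longrightarrow> decreasing (exchange S t)"
  by (induction t) auto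

lemma branching_exchange [simp]: "branching (exchange S t) = branching t"
  by (induction t) auto

lemma childless_exchange [simp]: "childless (exchange S t) = childless t"
  by (induction t) auto

lemma exchange_cong: "S \<inter> set_tree t = T \<inter> set_tree t \<Longrightarrow> exchange S t = exchange T t"
proof (induction t)
  case (Node l x r)
  have "exchange S l = exchange T l" "exchange S r = exchange T r"
    using Node by (simp_all, blast+)
  moreover have "x \<in> S \<longleftrightarrow> x \<in> T" using Node.prems by auto
  ultimately show ?case by simp
qed simp

lemma exchange_empty [simp]: "exchange {} t = t"
  by (induction t) auto

lemma exchange_disjoint: "S \<inter> set_tree t = {} \<Longrightarrow> exchange S t = t"
  using exchange_cong[of S t "{}"] by simp

lemma exchange_exchange: "S \<inter> T = {} \<Longrightarrow> exchange S (exchange T t) = exchange (S \<union> T) t"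
  by (induction t) auto

section \<open>Factorizations and neighbours in the inorder word\<close>

lemma x_factorizationI:
  assumes "x \<notin> set w1" "\<forall>y\<in>set w2. y < x" "\<forall>y\<in>set w4. y < x"
    and "w1 = [] \<or> last w1 > x" "w5 = [] \<or> hd w5 > x"
  shows "x_factorization x (w1 @ w2 @ x # w4 @ w5) = (w1, w2, w4, w5)"
proof -
  have "x \<notin> set w2" using assms(2) by auto
  have l: "takeWhile (\<lambda>y. y \<noteq> x) (w1 @ w2 @ x # w4 @ w5) = w1 @ w2"
    using assms(1) \<open>x \<notin> set w2\<close> by (subst append_assoc[symmetric], subst takeWhile_append2) auto
  have r: "tl (dropWhile (\<lambda>y. y \<noteq> x) (w1 @ w2 @ x # w4 @ w5)) = w4 @ w5"
    using assms(1) \<open>x \<notin> set w2\<close> by (subst append_assoc[symmetric], subst dropWhile_append2) auto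
  have w1: "takeWhile (\<lambda>y. y < x) (rev w1) = []" "dropWhile (\<lambda>y. y < x) (rev w1) = rev w1"
    using assms(4) by (cases w1 rule: rev_cases; auto)+
  have w5: "takeWhile (\<lambda>y. y < x) w5 = []" "dropWhile (\<lambda>y. y < x) w5 = w5"
    using assms(5) by (cases w5; auto)+
  show ?thesis
    unfolding x_factorization_def Let_def l r using assms(2,3) w1 w5
    by (simp add: takeWhile_append dropWhile_append)
qed

text \<open>
  The words \<open>w1\<close> and \<open>w5\<close> around a subtree, with the letters that bound it. The set \<open>A\<close> prepares
  for the restriction to \<open>P \<union> V\<close>. An ancestor \<open>y\<close> of \<open>x\<close> with \<open>y \<notin> A\<close> has only one child, so on the
  side where \<open>y\<close> bounds the factor, nothing follows \<open>y\<close> inside the subtree at \<open>y\<close>; the next bound is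
  a higher, hence larger, ancestor. Thus deleting such letters leaves each factor bounded by a
  letter larger than \<open>x\<close> or by an end of the word.
\<close>

lemma subtree_context:
  assumes "decreasing t" "Node l x r \<in> subtrees t" "branching t \<subseteq> A"
  shows "\<exists>w1 w5. inorder t = w1 @ inorder l @ x # inorder r @ w5 \<and>
     inorder (exchange {x} t) = w1 @ inorder r @ x # inorder l @ w5 \<and>
     (filter (\<lambda>y. y \<in> A) w1 = [] \<or> last (filter (\<lambda>y. y \<in> A) w1) > x) \<and>
     (filter (\<lambda>y. y \<in> A) w5 = [] \<or> hd (filter (\<lambda>y. y \<in> A) w5) > x)"
  using assms
proof (induction t)
  case Leaf
  then show ?case by simp
next
  case (Node L y R)
  consider (root) "Node l x r = Node L y R" | (left) "Node l x r \<in> subtrees L"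
    | (right) "Node l x r \<in> subtrees R" using Node.prems by auto
  then show ?case
  proof cases
    case root
    then have "x \<notin> set_tree l" "x \<notin> set_tree r" using Node.prems by auto
    then have "exchange {x} (Node L y R) = Node R y L"
      using root by (simp add: exchange_disjoint)
    then show ?thesis using root by (intro exI[of _ "[]"]) simp
  next
    case left
    have x: "x \<in> set_tree L" using subtrees_set_tree[OF left] by simp
    then have "x < y" "x \<notin> set_tree R" "L \<noteq> Leaf" using Node.prems by auto
    then have ex: "exchange {x} (Node L y R) = Node (exchange {x} L) y R"
      by (simp add: exchange_disjoint)
    from Node.IH(1)[OF _ left] Node.prems obtain w1 w5 where
      w: "inorder L = w1 @ inorder l @ x # inorder r @ w5"
        "inorder (exchange {x} L) = w1 @ inorder r @ x # inorder l @ w5"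
        "filter (\<lambda>y. y \<in> A) w1 = [] \<or> last (filter (\<lambda>y. y \<in> A) w1) > x"
        "filter (\<lambda>y. y \<in> A) w5 = [] \<or> hd (filter (\<lambda>y. y \<in> A) w5) > x" by auto
    have "R = Leaf \<or> y \<in> A" using Node.prems \<open>L \<noteq> Leaf\<close> by (auto split: if_splits)
    then show ?thesis using w ex \<open>x < y\<close>
      by - (rule exI[of _ w1], rule exI[of _ "w5 @ y # inorder R"],
        auto simp: hd_append)
  next
    case right
    have x: "x \<in> set_tree R" using subtrees_set_tree[OF right] by simp
    then have "x < y" "x \<notin> set_tree L" "R \<noteq> Leaf" using Node.prems by auto
    then have ex: "exchange {x} (Node L y R) = Node L y (exchange {x} R)"
      by (simp add: exchange_disjoint)
    from Node.IH(2)[OF _ right] Node.prems obtain w1 w5 where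
      w: "inorder R = w1 @ inorder l @ x # inorder r @ w5"
        "inorder (exchange {x} R) = w1 @ inorder r @ x # inorder l @ w5"
        "filter (\<lambda>y. y \<in> A) w1 = [] \<or> last (filter (\<lambda>y. y \<in> A) w1) > x"
        "filter (\<lambda>y. y \<in> A) w5 = [] \<or> hd (filter (\<lambda>y. y \<in> A) w5) > x" by auto
    have "L = Leaf \<or> y \<in> A" using Node.prems \<open>R \<noteq> Leaf\<close> by (auto split: if_splits)
    then show ?thesis using w ex \<open>x < y\<close>
      by - (rule exI[of _ "inorder L @ y # w1"], rule exI[of _ w5], auto)
  qed
qed

lemma subtree_less:
  "decreasing t \<Longrightarrow> Node l x r \<in> subtrees t \<Longrightarrow> \<forall>y\<in>set_tree l \<union> set_tree r. y < x"
  using decreasing_subtrees by fastforce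

lemma x_factorization_restrict_inorder:
  assumes "decreasing t" "Node l x r \<in> subtrees t" "branching t \<subseteq> A" "x \<in> A"
  shows "\<exists>w1 w5. x_factorization x (restrict_word A (inorder t)) =
    (w1, restrict_word A (inorder l), restrict_word A (inorder r), w5)"
proof -
  obtain w1 w5 where w: "inorder t = w1 @ inorder l @ x # inorder r @ w5"
     "filter (\<lambda>y. y \<in> A) w1 = [] \<or> last (filter (\<lambda>y. y \<in> A) w1) > x"
     "filter (\<lambda>y. y \<in> A) w5 = [] \<or> hd (filter (\<lambda>y. y \<in> A) w5) > x"
    using subtree_context[OF assms(1-3)] by blast
  have "x \<notin> set w1" using decreasing_distinct[OF assms(1)] w(1) by simp
  then have "x_factorization x (restrict_word A w1 @ restrict_word A (inorder l) @
      x # restrict_word A (inorder r) @ restrict_word A w5) =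
    (restrict_word A w1, restrict_word A (inorder l), restrict_word A (inorder r),
     restrict_word A w5)"
    using w(2,3) subtree_less[OF assms(1,2)]
    by (intro x_factorizationI) (auto simp: restrict_word_def)
  then show ?thesis using w(1) assms(4) by (auto simp: restrict_word_def)
qed

lemma dual_fs_inorder:
  assumes "decreasing t" "x \<in> set_tree t"
  shows "dual_fs x (inorder t) = inorder (exchange {x} t)"
proof -
  obtain l r where n: "Node l x r \<in> subtrees t" using set_tree_subtrees[OF assms(2)] by blast
  obtain w1 w5 where w: "inorder t = w1 @ inorder l @ x # inorder r @ w5"
     "inorder (exchange {x} t) = w1 @ inorder r @ x # inorder l @ w5"
     "w1 = [] \<or> last w1 > x" "w5 = [] \<or> hd w5 > x"
    using subtree_context[OF assms(1) n, of UNIV] by auto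
  have "x \<notin> set w1" using decreasing_distinct[OF assms(1)] w(1) by simp
  then have "x_factorization x (inorder t) = (w1, inorder l, inorder r, w5)"
    unfolding w(1) using w(3,4) subtree_less[OF assms(1) n]
    by (intro x_factorizationI) auto
  then show ?thesis by (simp add: dual_fs_def w(2))
qed

lemma fold_dual_fs_inorder:
  "decreasing t \<Longrightarrow> distinct ys \<Longrightarrow> set ys \<subseteq> set_tree t \<Longrightarrow>
     fold dual_fs ys (inorder t) = inorder (exchange (set ys) t)"
proof (induction ys arbitrary: t)
  case (Cons y ys)
  then have "fold dual_fs (y # ys) (inorder t) = inorder (exchange (set ys) (exchange {y} t))"
    by (simp add: dual_fs_inorder decreasing_exchange)
  also have "\<dots> = inorder (exchange (set (y # ys)) t)"
    using Cons.prems(2) by (subst exchange_exchange) auto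
  finally show ?case .
qed simp

lemma dual_fs_set_inorder:
  assumes "decreasing t" "S \<subseteq> set_tree t"
  shows "dual_fs_set S (inorder t) = inorder (exchange S t)"
proof -
  have "finite S" using assms(2) finite_set_tree finite_subset by blast
  then show ?thesis
    unfolding dual_fs_set_def using fold_dual_fs_inorder[OF assms(1)] assms(2) by simp
qed

section \<open>Pinnacles, vales and double descents as node types\<close>

abbreviation left_neighbour :: "nat list \<Rightarrow> enat" where
  "left_neighbour u \<equiv> (if u = [] then \<infinity> else enat (last u))"

abbreviation right_neighbour :: "nat list \<Rightarrow> enat" where
  "right_neighbour v \<equiv> (if v = [] then \<infinity> else enat (hd v))"

lemma entry_split:
  "entry (u @ x # v) (length u) = left_neighbour u"
  "entry (u @ x # v) (Suc (length u)) = enat x"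
  "entry (u @ x # v) (Suc (Suc (length u))) = right_neighbour v"
  by (cases u rule: rev_cases; auto simp: entry_def nth_append)
     (auto simp: entry_def nth_append hd_conv_nth Suc_le_eq)

lemma index_split:
  assumes "i \<in> {1..length \<sigma>}"
  obtains u x v where "\<sigma> = u @ x # v" "i = Suc (length u)"
proof -
  have "i - 1 < length \<sigma>" using assms by auto
  then have "\<sigma> = take (i - 1) \<sigma> @ \<sigma> ! (i - 1) # drop (Suc (i - 1)) \<sigma>"
    by (rule id_take_nth_drop)
  moreover have "i = Suc (length (take (i - 1) \<sigma>))" using assms by auto
  ultimately show ?thesis using that by blast
qed

text \<open>
  Pinnacles, vales and double descents are all defined by a relation \<open>Q\<close> between an entry and its
  two neighbours; this passes from positions to factorizations of the word.
\<close>

lemma ex_index_iff_ex_split: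
  "(\<exists>i\<in>{1..length \<sigma>}. Q (entry \<sigma> (i - 1)) (entry \<sigma> i) (entry \<sigma> (i + 1))) \<longleftrightarrow>
   (\<exists>u x v. \<sigma> = u @ x # v \<and> Q (left_neighbour u) (enat x) (right_neighbour v))"
  (is "?L \<longleftrightarrow> ?R")
proof
  assume ?L
  then obtain i where i: "i \<in> {1..length \<sigma>}"
    and Q: "Q (entry \<sigma> (i - 1)) (entry \<sigma> i) (entry \<sigma> (i + 1))" by blast
  obtain u x v where s: "\<sigma> = u @ x # v" "i = Suc (length u)" using index_split[OF i] .
  have "Q (left_neighbour u) (enat x) (right_neighbour v)"
    using Q unfolding s by (simp only: diff_Suc_1 entry_split Suc_eq_plus1[symmetric])
  then show ?R using s(1) by blast
next
  assume ?R
  then obtain u x v where s: "\<sigma> = u @ x # v"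
    and Q: "Q (left_neighbour u) (enat x) (right_neighbour v)" by blast
  show ?L
  proof (rule bexI[of _ "Suc (length u)"])
    show "Q (entry \<sigma> (Suc (length u) - 1)) (entry \<sigma> (Suc (length u)))
        (entry \<sigma> (Suc (length u) + 1))"
      using Q unfolding s by (simp only: diff_Suc_1 entry_split Suc_eq_plus1[symmetric])
  qed (simp add: s)
qed

text \<open>
  Next to \<open>x\<close> stands a letter of the subtree on that side if there is one, and otherwise a larger
  letter or \<open>\<infinity>\<close>.
\<close>

lemma subtree_neighbours:
  assumes "decreasing t" "Node l x r \<in> subtrees t"
  shows "\<exists>u v. inorder t = u @ x # v \<and>
    (if l = Leaf then left_neighbour u > enat x else left_neighbour u < enat x) \<and>
    (if r = Leaf then right_neighbour v > enat x else right_neighbour v < enat x)"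
proof -
  obtain w1 w5 where w: "inorder t = w1 @ inorder l @ x # inorder r @ w5"
     "w1 = [] \<or> last w1 > x" "w5 = [] \<or> hd w5 > x"
    using subtree_context[OF assms, of UNIV] by auto
  have "l \<noteq> Leaf \<Longrightarrow> last (inorder l) < x"
    using subtree_less[OF assms] last_in_set[of "inorder l"] by simp
  moreover have "r \<noteq> Leaf \<Longrightarrow> hd (inorder r) < x"
    using subtree_less[OF assms] hd_in_set[of "inorder r"] by simp
  ultimately show ?thesis using w
    by - (rule exI[of _ "w1 @ inorder l"], rule exI[of _ "inorder r @ w5"], auto)
qed

lemma split_neighbours:
  assumes "decreasing t" "inorder t = u @ x # v"
  shows "\<exists>l r. Node l x r \<in> subtrees t \<and>
    (if l = Leaf then left_neighbour u > enat x else left_neighbour u < enat x) \<and>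
    (if r = Leaf then right_neighbour v > enat x else right_neighbour v < enat x)"
proof -
  have "x \<in> set_tree t" using assms(2) by (metis in_set_conv_decomp set_inorder)
  then obtain l r where n: "Node l x r \<in> subtrees t" using set_tree_subtrees by metis
  obtain u' v' where s: "inorder t = u' @ x # v'"
    "if l = Leaf then left_neighbour u' > enat x else left_neighbour u' < enat x"
    "if r = Leaf then right_neighbour v' > enat x else right_neighbour v' < enat x"
    using subtree_neighbours[OF assms(1) n] by blast
  have "distinct (u @ x # v)" using decreasing_distinct[OF assms(1)] assms(2) by simp
  then have "u' = u" "v' = v"
    using s(1) assms(2) append_Cons_eq_iff[of x u v u' v'] by auto
  then show ?thesis using n s(2,3) by blast
qed

lemma Pin_inorder:
  assumes "decreasing t" shows "Pin (inorder t) = branching t"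
proof (intro set_eqI iffI)
  fix x assume "x \<in> Pin (inorder t)"
  then obtain u v where "inorder t = u @ x # v" "left_neighbour u < enat x"
    "right_neighbour v < enat x"
    unfolding Pin_def mem_Collect_eq
    by (subst (asm) ex_index_iff_ex_split[where Q = "\<lambda>a b c. enat x = b \<and> a < b \<and> b > c"]) auto
  then show "x \<in> branching t"
    using split_neighbours[OF assms, of u x v] unfolding branching_def mem_Collect_eq
    by (metis order.asym)
next
  fix x assume "x \<in> branching t"
  then obtain u v where "inorder t = u @ x # v" "left_neighbour u < enat x"
    "right_neighbour v < enat x"
    using subtree_neighbours[OF assms] unfolding branching_def mem_Collect_eq by metis
  then show "x \<in> Pin (inorder t)"
    unfolding Pin_def mem_Collect_eq
    by (subst ex_index_iff_ex_split[where Q = "\<lambda>a b c. enat x = b \<and> a < b \<and> b > c"]) blast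
qed

lemma Vale_inorder:
  assumes "decreasing t" shows "Vale (inorder t) = childless t"
proof (intro set_eqI iffI)
  fix x assume "x \<in> Vale (inorder t)"
  then obtain u v where "inorder t = u @ x # v" "left_neighbour u > enat x"
    "right_neighbour v > enat x"
    unfolding Vale_def mem_Collect_eq
    by (subst (asm) ex_index_iff_ex_split[where Q = "\<lambda>a b c. enat x = b \<and> a > b \<and> b < c"]) auto
  then show "x \<in> childless t"
    using split_neighbours[OF assms, of u x v] unfolding childless_def mem_Collect_eq
    by (metis order.asym)
next
  fix x assume "x \<in> childless t"
  then obtain u v where "inorder t = u @ x # v" "left_neighbour u > enat x"
    "right_neighbour v > enat x"
    using subtree_neighbours[OF assms] unfolding childless_def mem_Collect_eq by metis
  then show "x \<in> Vale (inorder t)"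
    unfolding Vale_def mem_Collect_eq
    by (subst ex_index_iff_ex_split[where Q = "\<lambda>a b c. enat x = b \<and> a > b \<and> b < c"]) blast
qed

lemma double_descent_inorder:
  assumes "decreasing t"
  shows "(\<exists>i. double_descent (inorder t) i) \<longleftrightarrow>
    (\<exists>x r. Node Leaf x r \<in> subtrees t \<and> r \<noteq> Leaf)"
proof -
  have "(\<exists>i. double_descent (inorder t) i) \<longleftrightarrow> (\<exists>u x v. inorder t = u @ x # v \<and>
      left_neighbour u > enat x \<and> enat x > right_neighbour v)"
    unfolding double_descent_def
    using ex_index_iff_ex_split[where Q = "\<lambda>a b c. a > b \<and> b > c" and \<sigma> = "inorder t"] by blast
  also have "\<dots> \<longleftrightarrow> (\<exists>x r. Node Leaf x r \<in> subtrees t \<and> r \<noteq> Leaf)"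
  proof
    assume "\<exists>u x v. inorder t = u @ x # v \<and>
      left_neighbour u > enat x \<and> enat x > right_neighbour v"
    then obtain u x v where "inorder t = u @ x # v"
      "left_neighbour u > enat x" "enat x > right_neighbour v" by blast
    then show "\<exists>x r. Node Leaf x r \<in> subtrees t \<and> r \<noteq> Leaf"
      using split_neighbours[OF assms, of u x v] by (metis order.asym)
  next
    assume "\<exists>x r. Node Leaf x r \<in> subtrees t \<and> r \<noteq> Leaf"
    then show "\<exists>u x v. inorder t = u @ x # v \<and>
      left_neighbour u > enat x \<and> enat x > right_neighbour v"
      using subtree_neighbours[OF assms] by metis
  qed
  finally show ?thesis .
qed

section \<open>FS-minimality as an orientation of the nodes\<close>

definition node_oriented :: "nat set \<Rightarrow> nat tree \<Rightarrow> nat tree \<Rightarrow> bool" where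
  "node_oriented A l r \<longleftrightarrow> (l = Leaf \<longrightarrow> r = Leaf) \<and>
     (l \<noteq> Leaf \<and> r \<noteq> Leaf \<longrightarrow> Max (set_tree l \<inter> A) < Max (set_tree r \<inter> A))"

definition oriented :: "nat set \<Rightarrow> nat tree \<Rightarrow> bool" where
  "oriented A t \<longleftrightarrow> (\<forall>l x r. Node l x r \<in> subtrees t \<longrightarrow> node_oriented A l r)"

lemma oriented_simps [simp]:
  "oriented A Leaf"
  "oriented A (Node l x r) \<longleftrightarrow> node_oriented A l r \<and> oriented A l \<and> oriented A r"
  by (auto simp: oriented_def)

lemma node_oriented_exchange [simp]:
  "node_oriented A (exchange S l) (exchange T r) \<longleftrightarrow> node_oriented A l r"
  by (simp add: node_oriented_def)

lemma FS_minimal_inorder: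
  assumes "decreasing t" "set_tree t = {1..n}"
  shows "FS_minimal n (inorder t) \<longleftrightarrow> oriented (branching t \<union> childless t) t"
proof -
  let ?A = "branching t \<union> childless t"
  have perm: "inorder t \<in> permutations_of_set {1..n}"
    using assms decreasing_distinct by (simp add: permutations_of_set_def)
  have fact: "(case x_factorization x (restrict_word ?A (inorder t)) of
      (w1, w2, w4, w5) \<Rightarrow> Max (set w2) < Max (set w4)) \<longleftrightarrow>
      Max (set_tree l \<inter> ?A) < Max (set_tree r \<inter> ?A)"
    if node: "Node l x r \<in> subtrees t" "l \<noteq> Leaf" "r \<noteq> Leaf" for l x r
  proof -
    have "x \<in> ?A" using node by (auto simp: branching_def)
    then obtain w1 w5 where "x_factorization x (restrict_word ?A (inorder t)) =
      (w1, restrict_word ?A (inorder l), restrict_word ?A (inorder r), w5)"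
      using x_factorization_restrict_inorder[OF assms(1) node(1), of ?A] by blast
    moreover have "set (restrict_word ?A (inorder s)) = set_tree s \<inter> ?A" for s
      by (auto simp: restrict_word_def)
    ultimately show ?thesis by simp
  qed
  have nodes: "(\<forall>p\<in>branching t. case x_factorization p (restrict_word ?A (inorder t)) of
      (w1, w2, w4, w5) \<Rightarrow> Max (set w2) < Max (set w4)) \<longleftrightarrow>
    (\<forall>l x r. Node l x r \<in> subtrees t \<longrightarrow> l \<noteq> Leaf \<longrightarrow> r \<noteq> Leaf \<longrightarrow>
      Max (set_tree l \<inter> ?A) < Max (set_tree r \<inter> ?A))"
    using fact unfolding branching_def mem_Collect_eq Ball_def by meson
  show ?thesis
    unfolding FS_minimal_def Pin_inorder[OF assms(1)] Vale_inorder[OF assms(1)]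
      double_descent_inorder[OF assms(1)] oriented_def node_oriented_def nodes
    using perm by blast
qed

text \<open>
  If two choices differ at a node, then its subtrees satisfy the orientation condition in both
  orders, which forces both to be empty.
\<close>

lemma oriented_exchange_unique:
  "oriented A (exchange S t) \<Longrightarrow> oriented A (exchange T t) \<Longrightarrow> exchange S t = exchange T t"
proof (induction t)
  case (Node l x r)
  have sub: "exchange S l = exchange T l" "exchange S r = exchange T r"
    using Node by (auto split: if_splits)
  show ?case
  proof (cases "x \<in> S \<longleftrightarrow> x \<in> T")
    case True
    then show ?thesis using sub by simp
  next
    case False
    then have "node_oriented A l r" "node_oriented A r l"
      using Node.prems by (auto split: if_splits)
    then have "l = Leaf" "r = Leaf" by (auto simp: node_oriented_def)
    then show ?thesis by simp
  qed
qed simp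

text \<open>
  The letters of \<open>A\<close> include a childless node of every nonempty subtree, so both maxima range over
  nonempty sets; these are disjoint, so the maxima differ.
\<close>

lemma node_oriented_total:
  assumes "set_tree l \<inter> set_tree r = {}" "childless l \<subseteq> A" "childless r \<subseteq> A"
  shows "node_oriented A l r \<or> node_oriented A r l"
proof (cases "l = Leaf \<or> r = Leaf")
  case True
  then show ?thesis by (auto simp: node_oriented_def)
next
  case False
  then have ne: "set_tree l \<inter> A \<noteq> {}" "set_tree r \<inter> A \<noteq> {}"
    using childless_nonempty childless_subset assms(2,3) by fast+
  have "Max (set_tree l \<inter> A) \<in> set_tree l" "Max (set_tree r \<inter> A) \<in> set_tree r"
    using Max_in[OF _ ne(1)] Max_in[OF _ ne(2)] by auto
  then have "Max (set_tree l \<inter> A) \<noteq> Max (set_tree r \<inter> A)" using assms(1) by auto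
  then show ?thesis using False by (auto simp: node_oriented_def)
qed

lemma ex_oriented_exchange:
  assumes "decreasing t" "childless t \<subseteq> A"
  shows "\<exists>S\<subseteq>set_tree t. oriented A (exchange S t)"
  using assms
proof (induction t)
  case (Node l x r)
  obtain S where S: "S \<subseteq> set_tree l" "oriented A (exchange S l)" using Node by auto
  obtain T where T: "T \<subseteq> set_tree r" "oriented A (exchange T r)" using Node by auto
  have disj: "set_tree l \<inter> set_tree r = {}" and x: "x \<notin> set_tree l" "x \<notin> set_tree r"
    using Node.prems by auto
  define U where "U = (if node_oriented A l r then {} else {x}) \<union> S \<union> T"
  have "U \<inter> set_tree l = S \<inter> set_tree l" "U \<inter> set_tree r = T \<inter> set_tree r"
    using S(1) T(1) disj x by (auto simp: U_def)
  then have "exchange U l = exchange S l" "exchange U r = exchange T r"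
    using exchange_cong by blast+
  moreover have "x \<in> U \<longleftrightarrow> \<not> node_oriented A l r" using S(1) T(1) x by (auto simp: U_def)
  moreover have "node_oriented A l r \<or> node_oriented A r l"
    using node_oriented_total[OF disj] Node.prems(2) by simp
  ultimately have "oriented A (exchange U (Node l x r))" using S(2) T(2) by auto
  moreover have "U \<subseteq> set_tree (Node l x r)" using S(1) T(1) by (auto simp: U_def)
  ultimately show ?case by blast
qed simp

theorem theorem3p6:
  fixes n :: nat and \<pi> :: "nat list" and P V :: "nat set"
  assumes "\<pi> \<in> permutations_of_set {1..n}"
    and "Pin \<pi> = P" and "Vale \<pi> = V"
  shows "\<exists>!\<sigma>. \<sigma> \<in> dual_fs_orbit n \<pi> \<and> FS_minimal n \<sigma>"
proof -
  obtain t where t: "decreasing t" "inorder t = \<pi>"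
    using ex_decreasing_tree assms(1) by (metis permutations_of_setD(2))
  have set_t: "set_tree t = {1..n}"
    using t(2) assms(1) by (metis permutations_of_setD(1) set_inorder)
  let ?A = "branching t \<union> childless t"
  have orbit: "dual_fs_orbit n \<pi> = {inorder (exchange S t) | S. S \<subseteq> {1..n}}"
    unfolding dual_fs_orbit_def using dual_fs_set_inorder[OF t(1)] t(2) set_t by metis
  have minimal: "FS_minimal n (inorder (exchange S t)) \<longleftrightarrow> oriented ?A (exchange S t)" for S
    using FS_minimal_inorder[OF decreasing_exchange[OF t(1)], of S n] set_t by simp
  obtain S where "S \<subseteq> {1..n}" "oriented ?A (exchange S t)"
    using ex_oriented_exchange[OF t(1), of ?A] set_t by auto
  then show ?thesis
    unfolding orbit using minimal oriented_exchange_unique[of ?A _ t]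
    by (intro ex1I[of _ "inorder (exchange S t)"]) (blast, fastforce)
qed

end
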